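(* Let $m\ge1$ be an integer and $0<\theta\le 1$, and consider the extended occupancy process with $m$ bins and probability parameter $\theta$. Let $n\ge 1$ and $\acute n\ge 0$ be integers and let $0\le t\le k\le\min(n,m)$. Then $$\mathbb{P}(K_n=k)=\operatorname{Occ}(k\mid n,m,\theta),$$ and, if $t<m$ and $\mathbb{P}(K_{\acute n}=t)>0$, $$\mathbb{P}(K_{\acute n+n}=k\mid K_{\acute n}=t)=\operatorname{Occ}\big(k-t\mid n,\,m-t,\,\theta(1-t/m)\big).$$
   Context: Extended occupancy process: let $\tilde U_1,\tilde U_2,\dots$ be IID uniform on $\{1,\dots,m\}$ and $Q_1,Q_2,\dots$ be IID Bernoulli$(\theta)$, the two sequences independent of each other. Let $\bullet\notin\{1,\dots,m\}$ and set $U_i=\bullet$ if $Q_i=0$, $U_i=\tilde U_i$ if $Q_i=1$. The occupancy number is $K_n=\sum_{\ell=1}^m\mathbb{I}\big(\sum_{i=1}^n\mathbb{I}(U_i=\ell)>0\big)$, with $K_0=0$. Noncentral Stirling numbers of the second kind: for an integer $n\ge0$ and real $\phi$, the numbers $S(n,k,\phi)$, $0\le k\le n$, are defined by the polynomial identity $(x+\phi)^n=\sum_{k=0}^n S(n,k,\phi)(x)_k$, where $(x)_k=\prod_{i=0}^{k-1}(x-i)$; $S(n,k,\phi)=0$ for $k>n$. Extended occupancy distribution: for integers $n\ge0$, $m\ge1$, $k\ge0$ and $0<\theta\le1$, $\operatorname{Occ}(k\mid n,m,\theta)=\frac{\theta^n}{m^n}(m)_k\,S\big(n,k,m\tfrac{1-\theta}{\theta}\big)$.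 *)

theory Defs
  imports "HOL-Probability.Probability" "HOL-Computational_Algebra.Polynomial"
begin

definition falling_fact :: "'a :: comm_ring_1 \<Rightarrow> nat \<Rightarrow> 'a" where
  "falling_fact x k = (\<Prod>i<k. x - of_nat i)"

text \<open>The noncentral Stirling numbers of the second kind, as the coefficients of
  \<open>(x + \<phi>)^n\<close> in the falling factorial basis; here \<open>[:0, 1:]\<close> is the indeterminate and
  \<open>[:\<phi>, 1:]\<close> is \<open>x + \<phi>\<close>. Lemma \<open>ex1_noncentral_stirling2_coeffs\<close> justifies the
  definite description.\<close>

definition is_noncentral_stirling2_coeffs :: "nat \<Rightarrow> real \<Rightarrow> (nat \<Rightarrow> real) \<Rightarrow> bool" where
  "is_noncentral_stirling2_coeffs n \<phi> s \<longleftrightarrow>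
     [:\<phi>, 1:] ^ n = (\<Sum>k\<le>n. smult (s k) (falling_fact [:0, 1:] k)) \<and> (\<forall>k>n. s k = 0)"

definition noncentral_stirling2 :: "nat \<Rightarrow> nat \<Rightarrow> real \<Rightarrow> real" where
  "noncentral_stirling2 n k \<phi> = (THE s. is_noncentral_stirling2_coeffs n \<phi> s) k"

lemma falling_fact_Suc: "falling_fact x (Suc k) = falling_fact x k * (x - of_nat k)"
  by (simp add: falling_fact_def)

lemma poly_falling_fact: "poly (falling_fact [:0, 1:] k) (x :: real) = falling_fact x k"
  by (simp add: falling_fact_def poly_prod)

lemma falling_fact_of_nat_eq_0: "j < k \<Longrightarrow> falling_fact (of_nat j :: real) k = 0"
  by (auto simp: falling_fact_def)

lemma falling_fact_of_nat_self: "falling_fact (of_nat j :: real) j \<noteq> 0"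
  by (auto simp: falling_fact_def)

lemma falling_fact_coeffs_unique:
  fixes s t :: "nat \<Rightarrow> real"
  assumes eq: "(\<Sum>k\<le>n. smult (s k) (falling_fact [:0, 1:] k)) =
               (\<Sum>k\<le>n. smult (t k) (falling_fact [:0, 1:] k))"
    and "j \<le> n"
  shows "s j = t j"
  using \<open>j \<le> n\<close>
proof (induction j rule: less_induct)
  case (less j)
  have *: "poly (\<Sum>k\<le>n. smult (u k) (falling_fact [:0, 1:] k)) (real j) =
      (\<Sum>k<j. u k * falling_fact (real j) k) + u j * falling_fact (real j) j"
    for u :: "nat \<Rightarrow> real"
  proof -
    have "poly (\<Sum>k\<le>n. smult (u k) (falling_fact [:0, 1:] k)) (real j) =
        (\<Sum>k\<le>n. u k * falling_fact (real j) k)"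
      by (simp add: poly_sum poly_falling_fact)
    also have "\<dots> = (\<Sum>k<Suc j. u k * falling_fact (real j) k)"
      using less.prems
      by (intro sum.mono_neutral_right) (auto simp: falling_fact_of_nat_eq_0)
    finally show ?thesis by simp
  qed
  have "(\<Sum>k<j. s k * falling_fact (real j) k) = (\<Sum>k<j. t k * falling_fact (real j) k)"
    using less by (intro sum.cong) auto
  then have "s j * falling_fact (real j) j = t j * falling_fact (real j) j"
    using *[of s] *[of t] eq by auto
  then show ?case using falling_fact_of_nat_self by simp
qed

lemma ex_noncentral_stirling2_coeffs: "\<exists>s. is_noncentral_stirling2_coeffs n \<phi> s"
proof (induction n)
  case 0
  show ?case
    by (intro exI[of _ "\<lambda>k. if k = 0 then 1 else 0"])
      (simp add: is_noncentral_stirling2_coeffs_def falling_fact_def)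
next
  case (Suc n)
  let ?F = "falling_fact ([:0, 1:] :: real poly)"
  obtain s where s: "[:\<phi>, 1:] ^ n = (\<Sum>k\<le>n. smult (s k) (?F k))"
    and s0: "\<And>k. k > n \<Longrightarrow> s k = 0"
    using Suc by (auto simp: is_noncentral_stirling2_coeffs_def)
  define u where "u = (\<lambda>k. (if k = 0 then 0 else s (k - 1)) + (\<phi> + real k) * s k)"
  have step: "[:\<phi>, 1:] * ?F k = ?F (Suc k) + smult (\<phi> + real k) (?F k)" for k
  proof -
    have "[:\<phi>, 1:] = ([:0, 1:] - of_nat k) + [:\<phi> + real k:]"
      by (simp add: of_nat_poly)
    then have "[:\<phi>, 1:] * ?F k = ([:0, 1:] - of_nat k) * ?F k + [:\<phi> + real k:] * ?F k"
      by (metis distrib_right)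
    then show ?thesis by (simp add: falling_fact_Suc mult.commute)
  qed
  have "[:\<phi>, 1:] ^ Suc n = (\<Sum>k\<le>n. smult (s k) ([:\<phi>, 1:] * ?F k))"
    by (simp only: power_Suc s sum_distrib_left mult_smult_right)
  also have "\<dots> = (\<Sum>k\<le>n. smult (s k) (?F (Suc k))) + (\<Sum>k\<le>n. smult ((\<phi> + real k) * s k) (?F k))"
    by (simp only: step smult_add_right sum.distrib smult_smult mult.commute)
  also have "(\<Sum>k\<le>n. smult ((\<phi> + real k) * s k) (?F k)) =
      (\<Sum>k\<le>Suc n. smult ((\<phi> + real k) * s k) (?F k))"
    by (simp add: s0)
  also have "(\<Sum>k\<le>n. smult (s k) (?F (Suc k))) =
      (\<Sum>k\<le>Suc n. smult (if k = 0 then 0 else s (k - 1)) (?F k))"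
    by (simp only: sum.atMost_Suc_shift) simp
  finally have "[:\<phi>, 1:] ^ Suc n = (\<Sum>k\<le>Suc n. smult (u k) (?F k))"
    by (simp only: u_def smult_add_left sum.distrib)
  moreover have "\<forall>k>Suc n. u k = 0" by (auto simp: u_def s0)
  ultimately show ?case unfolding is_noncentral_stirling2_coeffs_def by blast
qed

lemma ex1_noncentral_stirling2_coeffs: "\<exists>!s. is_noncentral_stirling2_coeffs n \<phi> s"
proof (rule ex_ex1I[OF ex_noncentral_stirling2_coeffs])
  fix s t
  assume s: "is_noncentral_stirling2_coeffs n \<phi> s" and t: "is_noncentral_stirling2_coeffs n \<phi> t"
  show "s = t"
  proof
    fix j
    show "s j = t j"
    proof (cases "j \<le> n")
      case True
      show ?thesis
        by (rule falling_fact_coeffs_unique[OF _ True])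
          (use s t in \<open>simp add: is_noncentral_stirling2_coeffs_def\<close>)
    qed (use s t in \<open>simp add: is_noncentral_stirling2_coeffs_def\<close>)
  qed
qed

definition Occ :: "nat \<Rightarrow> nat \<Rightarrow> nat \<Rightarrow> real \<Rightarrow> real" where
  "Occ k n m \<theta> = \<theta> ^ n / real m ^ n * falling_fact (real m) k
     * noncentral_stirling2 n k (real m * ((1 - \<theta>) / \<theta>))"

text \<open>The sequences are indexed from 1; the variables at index 0 are unconstrained and unused.
  The last conjunct is
  independence of the two sequences, each regarded as one random element of a product space.\<close>

definition extended_occupancy_process ::
  "'a measure \<Rightarrow> nat \<Rightarrow> real \<Rightarrow> (nat \<Rightarrow> 'a \<Rightarrow> nat) \<Rightarrow> (nat \<Rightarrow> 'a \<Rightarrow> nat) \<Rightarrow> bool" where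
  "extended_occupancy_process M m \<theta> U' Q \<longleftrightarrow>
     prob_space M \<and>
     prob_space.indep_vars M (\<lambda>_. count_space UNIV) U' {1..} \<and>
     (\<forall>i\<ge>1. distr M (count_space UNIV) (U' i) = measure_pmf (pmf_of_set {1..m})) \<and>
     prob_space.indep_vars M (\<lambda>_. count_space UNIV) Q {1..} \<and>
     (\<forall>i\<ge>1. distr M (count_space UNIV) (Q i) = measure_pmf (map_pmf of_bool (bernoulli_pmf \<theta>))) \<and>
     prob_space.indep_var M
       (\<Pi>\<^sub>M i\<in>{1..}. count_space UNIV) (\<lambda>\<omega>. \<lambda>i\<in>{1..}. U' i \<omega>)
       (\<Pi>\<^sub>M i\<in>{1..}. count_space UNIV) (\<lambda>\<omega>. \<lambda>i\<in>{1..}. Q i \<omega>)"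

text \<open>\<open>None\<close> plays the role of the extra point outside \<open>{1..m}\<close>.\<close>

definition extended_U ::
  "(nat \<Rightarrow> 'a \<Rightarrow> nat) \<Rightarrow> (nat \<Rightarrow> 'a \<Rightarrow> nat) \<Rightarrow> nat \<Rightarrow> 'a \<Rightarrow> nat option" where
  "extended_U U' Q i \<omega> = (if Q i \<omega> = 0 then None else Some (U' i \<omega>))"

definition occupancy_number ::
  "nat \<Rightarrow> (nat \<Rightarrow> 'a \<Rightarrow> nat) \<Rightarrow> (nat \<Rightarrow> 'a \<Rightarrow> nat) \<Rightarrow> nat \<Rightarrow> 'a \<Rightarrow> nat" where
  "occupancy_number m U' Q n \<omega> =
     (\<Sum>l=1..m. of_bool ((\<Sum>i=1..n. of_bool (extended_U U' Q i \<omega> = Some l) :: nat) > 0))"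

end

theory Submission
  imports Defs
begin

text \<open>Given that \<open>a\<close> bins are occupied after \<open>n\<close> draws, the next draw occupies a new bin with
  probability \<open>\<theta> (m - a) / m\<close>, independently of the history. Hence
  \<open>P(K_n' = t, K_{n' + n} = k)\<close> satisfies a two-term recurrence in \<open>n\<close>. Multiplying the defining
  identity of the noncentral Stirling numbers by \<open>x + \<phi>\<close> gives a recurrence for \<open>Occ\<close>, and the two
  agree under the substitution of \<open>k - t\<close>, \<open>m - t\<close>, \<open>\<theta> (1 - t/m)\<close> for \<open>k\<close>, \<open>m\<close>, \<open>\<theta>\<close>. The
  unconditional law is the case \<open>n' = t = 0\<close>.\<close>

section \<open>Recurrences for the noncentral Stirling numbers and for \<open>Occ\<close>\<close>

lemma is_noncentral_stirling2_coeffs_noncentral_stirling2: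
  "is_noncentral_stirling2_coeffs n \<phi> (\<lambda>k. noncentral_stirling2 n k \<phi>)"
  unfolding noncentral_stirling2_def using theI'[OF ex1_noncentral_stirling2_coeffs] by simp

lemma noncentral_stirling2_eqI:
  "is_noncentral_stirling2_coeffs n \<phi> s \<Longrightarrow> noncentral_stirling2 n k \<phi> = s k"
  unfolding noncentral_stirling2_def by (simp add: the1_equality[OF ex1_noncentral_stirling2_coeffs])

lemma noncentral_stirling2_0: "noncentral_stirling2 0 k \<phi> = of_bool (k = 0)"
  by (rule noncentral_stirling2_eqI)
    (simp add: is_noncentral_stirling2_coeffs_def falling_fact_def)

text \<open>Writing \<open>x + \<phi> = (x - k) + (\<phi> + k)\<close> makes multiplication by
  \<open>x + \<phi>\<close> send \<open>(x)_k\<close> to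
  \<open>(x)_(k+1) + (\<phi> + k) (x)_k\<close>. The right-hand side therefore satisfies the
  defining identity for \<open>Suc n\<close>, and coefficients in the falling factorial basis are
  unique.\<close>

lemma noncentral_stirling2_Suc:
  "noncentral_stirling2 (Suc n) k \<phi> =
     (if k = 0 then 0 else noncentral_stirling2 n (k - 1) \<phi>) + (\<phi> + real k) * noncentral_stirling2 n k \<phi>"
proof (rule noncentral_stirling2_eqI)
  let ?F = "falling_fact ([:0, 1:] :: real poly)" and ?s = "\<lambda>k. noncentral_stirling2 n k \<phi>"
  let ?u = "\<lambda>k. (if k = 0 then 0 else ?s (k - 1)) + (\<phi> + real k) * ?s k"
  have s: "[:\<phi>, 1:] ^ n = (\<Sum>k\<le>n. smult (?s k) (?F k))" and s0: "?s k = 0" if "k > n" for k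
    using is_noncentral_stirling2_coeffs_noncentral_stirling2[of n \<phi>] that
    by (auto simp: is_noncentral_stirling2_coeffs_def)
  have step: "[:\<phi>, 1:] * ?F k = ?F (Suc k) + smult (\<phi> + real k) (?F k)" for k
  proof -
    have "[:\<phi>, 1:] = ([:0, 1:] - of_nat k) + [:\<phi> + real k:]"
      by (simp add: of_nat_poly)
    then show ?thesis
      by (simp only: distrib_right) (simp add: falling_fact_Suc mult.commute)
  qed
  have "[:\<phi>, 1:] ^ Suc n = (\<Sum>k\<le>n. smult (?s k) ([:\<phi>, 1:] * ?F k))"
    \<comment> \<open>The premise \<open>k > n\<close> of \<open>s0\<close> is attached to
      \<open>s\<close> as well; the instance \<open>Suc n\<close> discharges it.\<close>
    by (simp only: power_Suc s[of "Suc n", simplified] sum_distrib_left mult_smult_right)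
  also have "\<dots> = (\<Sum>k\<le>n. smult (?s k) (?F (Suc k))) + (\<Sum>k\<le>n. smult ((\<phi> + real k) * ?s k) (?F k))"
    by (simp only: step smult_add_right sum.distrib smult_smult mult.commute)
  \<comment> \<open>Both sums are brought to the range up to \<open>Suc n\<close>: this one gains a
    term that vanishes by \<open>s0\<close>, the next one is shifted by one index.\<close>
  also have "(\<Sum>k\<le>n. smult ((\<phi> + real k) * ?s k) (?F k)) =
      (\<Sum>k\<le>Suc n. smult ((\<phi> + real k) * ?s k) (?F k))"
    by (simp add: s0)
  also have "(\<Sum>k\<le>n. smult (?s k) (?F (Suc k))) =
      (\<Sum>k\<le>Suc n. smult (if k = 0 then 0 else ?s (k - 1)) (?F k))"
    by (simp only: sum.atMost_Suc_shift) simp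
  finally have "[:\<phi>, 1:] ^ Suc n = (\<Sum>k\<le>Suc n. smult (?u k) (?F k))"
    by (simp only: smult_add_left sum.distrib)
  then show "is_noncentral_stirling2_coeffs (Suc n) \<phi> ?u"
    by (simp add: is_noncentral_stirling2_coeffs_def s0)
qed

lemma Occ_0: "Occ k 0 m \<theta> = of_bool (k = 0)"
  by (cases k) (simp_all add: Occ_def noncentral_stirling2_0 falling_fact_def)

text \<open>For \<open>\<phi> = m (1 - \<theta>) / \<theta>\<close>, the extra factor
  \<open>\<theta> / m\<close> turns the coefficient \<open>\<phi>\<close> of the Stirling recurrence
  into \<open>1 - \<theta>\<close>.\<close>

lemma Occ_0_Suc:
  assumes "m > 0" "\<theta> \<noteq> 0"
  shows "Occ 0 (Suc n) m \<theta> = (1 - \<theta>) * Occ 0 n m \<theta>"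
  using assms by (simp add: Occ_def noncentral_stirling2_Suc falling_fact_def field_simps)

text \<open>Here \<open>(\<theta> / m) (\<phi> + k + 1) = 1 - \<theta> (m - (k + 1)) / m\<close>,
  the probability of staying at \<open>k + 1\<close> occupied bins; the other weight comes from
  \<open>(m)_(k+1) = (m)_k (m - k)\<close>.\<close>

lemma Occ_Suc_Suc:
  assumes "m > 0" "\<theta> \<noteq> 0"
  shows "Occ (Suc k) (Suc n) m \<theta> =
    (1 - \<theta> * (real m - real (Suc k)) / real m) * Occ (Suc k) n m \<theta>
      + \<theta> * (real m - real k) / real m * Occ k n m \<theta>"
  using assms by (simp add: Occ_def noncentral_stirling2_Suc falling_fact_Suc field_simps)

section \<open>Independence of a sequence of pairs\<close>

lemma restrict_in_prod_emb_iff: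
  assumes "K \<subseteq> I" "\<And>i. i \<in> I \<Longrightarrow> x i \<in> space (N i)"
  shows "restrict x I \<in> prod_emb I N K (Pi\<^sub>E K A) \<longleftrightarrow> (\<forall>j\<in>K. x j \<in> A j)"
proof -
  have "restrict (restrict x I) K = restrict x K"
    using assms(1) by (simp add: Int_absorb1)
  then show ?thesis
    using assms(2) by (simp add: prod_emb_iff PiE_iff)
qed

text \<open>Rectangles form an intersection-stable generator of each product \<sigma>-algebra, so it
  suffices to factor probabilities of finitely many rectangle events. Such a probability splits
  first between the two sequences by \<open>XY\<close>, then within each sequence by
  \<open>X\<close> and \<open>Y\<close>.\<close>

lemma (in prob_space) indep_vars_Pair:
  assumes X: "indep_vars N X I" and Y: "indep_vars L Y I"
    and XY: "indep_var (Pi\<^sub>M I N) (\<lambda>\<omega>. \<lambda>i\<in>I. X i \<omega>) (Pi\<^sub>M I L) (\<lambda>\<omega>. \<lambda>i\<in>I. Y i \<omega>)"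
  shows "indep_vars (\<lambda>i. N i \<Otimes>\<^sub>M L i) (\<lambda>i \<omega>. (X i \<omega>, Y i \<omega>)) I"
proof -
  let ?Z = "\<lambda>i \<omega>. (X i \<omega>, Y i \<omega>)"
  let ?R = "\<lambda>i. {A \<times> B |A B. A \<in> sets (N i) \<and> B \<in> sets (L i)}"
  let ?F = "\<lambda>i. {?Z i -` C \<inter> space M |C. C \<in> ?R i}"
  have rvX: "random_variable (N i) (X i)" and rvY: "random_variable (L i) (Y i)" if "i \<in> I" for i
    using X Y that by (auto simp: indep_vars_def)
  have indep: "indep_sets ?F I"
  proof (rule indep_setsI)
    fix i assume "i \<in> I"
    then show "?F i \<subseteq> events"
    proof safe
      fix A B assume "A \<in> sets (N i)" "B \<in> sets (L i)"
      then show "?Z i -` (A \<times> B) \<inter> space M \<in> events"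
        by (intro measurable_sets[OF measurable_Pair[OF rvX rvY]] pair_measureI \<open>i \<in> I\<close>)
    qed
  next
    fix C J assume J: "J \<noteq> {}" "J \<subseteq> I" "finite J" and "\<forall>j\<in>J. C j \<in> ?F j"
    then have "\<forall>j\<in>J. \<exists>P. P \<in> sets (N j) \<times> sets (L j) \<and> C j = ?Z j -` (fst P \<times> snd P) \<inter> space M"
      by (auto 4 3)
    from bchoice[OF this] obtain P where P: "\<forall>j\<in>J. P j \<in> sets (N j) \<times> sets (L j) \<and> C j = ?Z j -` (fst (P j) \<times> snd (P j)) \<inter> space M" ..
    define A B where "A j = fst (P j)" and "B j = snd (P j)" for j
    have AB: "\<And>j. j \<in> J \<Longrightarrow> A j \<in> sets (N j)" "\<And>j. j \<in> J \<Longrightarrow> B j \<in> sets (L j)"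
      and C: "\<And>j. j \<in> J \<Longrightarrow> C j = ?Z j -` (A j \<times> B j) \<inter> space M"
      using P by (auto simp: A_def B_def)
    \<comment> \<open>Stated for all \<open>K\<close> because it is applied twice: with
      \<open>K = J\<close> for the whole intersection and with \<open>K = {j}\<close> for each
      factor.\<close>
    have *: "prob ((\<Inter>j\<in>K. X j -` A j \<inter> space M) \<inter> (\<Inter>j\<in>K. Y j -` B j \<inter> space M)) =
        (\<Prod>j\<in>K. prob (X j -` A j \<inter> space M)) * (\<Prod>j\<in>K. prob (Y j -` B j \<inter> space M))"
      if K: "K \<subseteq> J" "K \<noteq> {}" for K
    proof -
      have K': "finite K" "K \<subseteq> I" using K J finite_subset by auto
      have AK: "\<And>j. j \<in> K \<Longrightarrow> A j \<in> sets (N j)" and BK: "\<And>j. j \<in> K \<Longrightarrow> B j \<in> sets (L j)"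
        using AB K by auto
      \<comment> \<open>Conditions on the coordinates in \<open>K\<close> become cylinder sets,
        since \<open>XY\<close> speaks only of the sequences as whole random elements.\<close>
      let ?A = "prod_emb I N K (Pi\<^sub>E K A)" and ?B = "prod_emb I L K (Pi\<^sub>E K B)"
      have "prob ((\<lambda>\<omega>. (\<lambda>i\<in>I. X i \<omega>, \<lambda>i\<in>I. Y i \<omega>)) -` (?A \<times> ?B) \<inter> space M) =
          prob ((\<lambda>\<omega>. \<lambda>i\<in>I. X i \<omega>) -` ?A \<inter> space M) * prob ((\<lambda>\<omega>. \<lambda>i\<in>I. Y i \<omega>) -` ?B \<inter> space M)"
        using K' AK BK by (intro indep_varD[OF XY] sets_PiM_I) auto
      moreover have "(\<lambda>\<omega>. \<lambda>i\<in>I. X i \<omega>) -` ?A \<inter> space M = (\<Inter>j\<in>K. X j -` A j \<inter> space M)"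
        using K K' measurable_space[OF rvX] by (auto simp: restrict_in_prod_emb_iff)
      moreover have "(\<lambda>\<omega>. \<lambda>i\<in>I. Y i \<omega>) -` ?B \<inter> space M = (\<Inter>j\<in>K. Y j -` B j \<inter> space M)"
        using K K' measurable_space[OF rvY] by (auto simp: restrict_in_prod_emb_iff)
      moreover have "(\<lambda>\<omega>. (\<lambda>i\<in>I. X i \<omega>, \<lambda>i\<in>I. Y i \<omega>)) -` (?A \<times> ?B) \<inter> space M =
          ((\<lambda>\<omega>. \<lambda>i\<in>I. X i \<omega>) -` ?A \<inter> space M) \<inter> ((\<lambda>\<omega>. \<lambda>i\<in>I. Y i \<omega>) -` ?B \<inter> space M)"
        by blast
      moreover have "prob (\<Inter>j\<in>K. X j -` A j \<inter> space M) = (\<Prod>j\<in>K. prob (X j -` A j \<inter> space M))"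
        using K K' AK by (intro indep_varsD[OF X]) auto
      moreover have "prob (\<Inter>j\<in>K. Y j -` B j \<inter> space M) = (\<Prod>j\<in>K. prob (Y j -` B j \<inter> space M))"
        using K K' BK by (intro indep_varsD[OF Y]) auto
      ultimately show ?thesis by simp
    qed
    have "(\<Inter>j\<in>J. C j) = (\<Inter>j\<in>J. X j -` A j \<inter> space M) \<inter> (\<Inter>j\<in>J. Y j -` B j \<inter> space M)"
      using C by auto
    moreover have "prob (C j) = prob (X j -` A j \<inter> space M) * prob (Y j -` B j \<inter> space M)"
      if "j \<in> J" for j
    proof -
      have "C j = (X j -` A j \<inter> space M) \<inter> (Y j -` B j \<inter> space M)" using C[OF that] by auto
      then show ?thesis using *[of "{j}"] that by simp
    qed
    ultimately show "prob (\<Inter>j\<in>J. C j) = (\<Prod>j\<in>J. prob (C j))"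
      using *[OF order_refl] J by (simp add: prod.distrib)
  qed
  have "Int_stable (?F i)" for i
  proof (rule Int_stableI)
    fix a b assume "a \<in> ?F i" "b \<in> ?F i"
    then obtain A B A' B' where
      "A \<in> sets (N i)" "B \<in> sets (L i)" "A' \<in> sets (N i)" "B' \<in> sets (L i)"
      "a = ?Z i -` (A \<times> B) \<inter> space M" "b = ?Z i -` (A' \<times> B') \<inter> space M"
      by blast
    then have "a \<inter> b = ?Z i -` ((A \<inter> A') \<times> (B \<inter> B')) \<inter> space M"
      "(A \<inter> A') \<times> (B \<inter> B') \<in> ?R i"
      by blast+
    then show "a \<inter> b \<in> ?F i" by blast
  qed
  with indep have "indep_sets (\<lambda>i. sigma_sets (space M) (?F i)) I"
    by (intro indep_sets_sigma)
  \<comment> \<open>Taking preimages commutes with generating \<sigma>-algebras, so preimages of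
    rectangles generate all events of the pair.\<close>
  moreover have "sigma_sets (space M) {?Z i -` A \<inter> space M |A. A \<in> sets (N i \<Otimes>\<^sub>M L i)} =
      sigma_sets (space M) (?F i)" if "i \<in> I" for i
  proof -
    have "?Z i \<in> space M \<rightarrow> space (N i) \<times> space (L i)"
      using measurable_space[OF rvX[OF that]] measurable_space[OF rvY[OF that]] by auto
    from sigma_sets_vimage_commute[OF this, of "?R i"]
    have "{?Z i -` A \<inter> space M |A. A \<in> sets (N i \<Otimes>\<^sub>M L i)} = sigma_sets (space M) (?F i)"
      by (simp add: sets_pair_measure)
    then show ?thesis
      using sigma_sets_sigma_sets_eq[of "?F i" "space M"] by force
  qed
  ultimately have "indep_sets (\<lambda>i. sigma_sets (space M)
      {?Z i -` A \<inter> space M |A. A \<in> sets (N i \<Otimes>\<^sub>M L i)}) I"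
    by (simp cong: indep_sets_cong)
  then show ?thesis
    using rvX rvY by (simp add: indep_vars_def)
qed

text \<open>A finite product of countable discrete spaces is again discrete. This lets arbitrary
  functions of a finite history of draws be used as random variables.\<close>

lemma measurable_PiM_count_space_finite:
  assumes "finite I"
  shows "f \<in> measurable (\<Pi>\<^sub>M i\<in>I. count_space (UNIV :: 'b :: countable set)) (count_space UNIV)"
  by (subst count_space_PiM_finite[OF assms]) auto

section \<open>Independence and law of the draws\<close>

locale extended_occupancy =
  fixes M :: "'a measure" and m :: nat and \<theta> :: real and U' Q :: "nat \<Rightarrow> 'a \<Rightarrow> nat"
  assumes m: "m \<ge> 1" and \<theta>: "0 < \<theta>" "\<theta> \<le> 1"
    and process: "extended_occupancy_process M m \<theta> U' Q"
begin

sublocale prob_space M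
  using process by (simp add: extended_occupancy_process_def)

abbreviation "U \<equiv> extended_U U' Q"
abbreviation "K \<equiv> occupancy_number m U' Q"

text \<open>Each \<open>U i\<close> is a function of the pair \<open>(U' i, Q i)\<close>, and these
  pairs are independent over \<open>i\<close>.\<close>

lemma indep_vars_U: "indep_vars (\<lambda>_. count_space UNIV) U {1..}"
proof -
  have "indep_vars (\<lambda>_. count_space UNIV \<Otimes>\<^sub>M count_space UNIV) (\<lambda>i \<omega>. (U' i \<omega>, Q i \<omega>)) {1..}"
    using process by (intro indep_vars_Pair) (auto simp: extended_occupancy_process_def)
  then have "indep_vars (\<lambda>_. count_space UNIV)
      (\<lambda>i \<omega>. (\<lambda>(u, q). if q = 0 then None else Some u) (U' i \<omega>, Q i \<omega>)) {1..}"
    by (rule indep_vars_compose2) (simp add: pair_measure_countable)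
  then show ?thesis by (simp add: extended_U_def[abs_def])
qed

lemma measurable_U [measurable]: "i \<ge> 1 \<Longrightarrow> U i \<in> measurable M (count_space UNIV)"
  using indep_vars_U by (auto simp: indep_vars_def)

text \<open>The event says that \<open>U' i\<close> lies in \<open>L\<close> and \<open>Q i\<close>
  is nonzero; these are independent with probabilities \<open>card L / m\<close> and
  \<open>\<theta>\<close>.\<close>

lemma prob_U_Some:
  assumes "i \<ge> 1" "L \<subseteq> {1..m}"
  shows "\<P>(\<omega> in M. U i \<omega> \<in> Some ` L) = \<theta> * card L / m"
proof -
  have ind: "indep_var
      (\<Pi>\<^sub>M i\<in>{1..}. count_space UNIV) (\<lambda>\<omega>. \<lambda>i\<in>{1..}. U' i \<omega>)
      (\<Pi>\<^sub>M i\<in>{1..}. count_space UNIV) (\<lambda>\<omega>. \<lambda>i\<in>{1..}. Q i \<omega>)"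
    and rv [measurable]: "U' i \<in> measurable M (count_space UNIV)" "Q i \<in> measurable M (count_space UNIV)"
    and dU: "distr M (count_space UNIV) (U' i) = measure_pmf (pmf_of_set {1..m})"
    and dQ: "distr M (count_space UNIV) (Q i) = measure_pmf (map_pmf of_bool (bernoulli_pmf \<theta>))"
    using process assms by (auto simp: extended_occupancy_process_def indep_vars_def)
  \<comment> \<open>Projecting to coordinate \<open>i\<close> passes from independence of the
    sequences to that of \<open>U' i\<close> and \<open>Q i\<close>.\<close>
  have comp: "(\<lambda>f. f i) \<circ> (\<lambda>\<omega>. \<lambda>i\<in>{1..}. X i \<omega>) = X i" for X :: "nat \<Rightarrow> 'a \<Rightarrow> nat"
    using assms by (auto simp: fun_eq_iff)
  have "indep_var (count_space UNIV) (U' i) (count_space UNIV) (Q i)"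
    using indep_var_compose[OF ind, of "\<lambda>f. f i" "count_space UNIV" "\<lambda>f. f i" "count_space UNIV"] assms
    unfolding comp by simp
  then have "prob ((\<lambda>\<omega>. (U' i \<omega>, Q i \<omega>)) -` (L \<times> {1..}) \<inter> space M) =
      prob (U' i -` L \<inter> space M) * prob (Q i -` {1..} \<inter> space M)"
    by (rule indep_varD) auto
  also have "prob (U' i -` L \<inter> space M) = measure (distr M (count_space UNIV) (U' i)) L"
    by (simp add: measure_distr)
  also have "\<dots> = card L / m"
    using m assms unfolding dU by (subst measure_pmf_of_set) (auto simp: Int_absorb1)
  also have "prob (Q i -` {1..} \<inter> space M) = measure (distr M (count_space UNIV) (Q i)) {1..}"
    by (simp add: measure_distr)
  also have "\<dots> = measure (bernoulli_pmf \<theta>) (of_bool -` {1::nat..})"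
    unfolding dQ by simp
  also have "of_bool -` {1::nat..} = {True}"
    by (auto simp: of_bool_def split: if_splits)
  also have "measure (bernoulli_pmf \<theta>) {True} = \<theta>"
    using \<theta> by (simp add: measure_pmf_single)
  also have "(\<lambda>\<omega>. (U' i \<omega>, Q i \<omega>)) -` (L \<times> {1..}) \<inter> space M = {\<omega> \<in> space M. U i \<omega> \<in> Some ` L}"
    by (auto simp: extended_U_def)
  finally show ?thesis by simp
qed

section \<open>Occupied bins and their evolution\<close>

text \<open>Taking a sequence of draws instead of a sample point allows evaluation on a restricted
  history, as independence of past and next draw requires.\<close>

definition occupied :: "nat \<Rightarrow> (nat \<Rightarrow> nat option) \<Rightarrow> nat set" where
  "occupied n u = {l \<in> {1..m}. \<exists>i\<in>{1..n}. u i = Some l}"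

abbreviation bins :: "nat \<Rightarrow> 'a \<Rightarrow> nat set" where
  "bins n \<omega> \<equiv> occupied n (\<lambda>i. U i \<omega>)"

definition fresh :: "nat \<Rightarrow> 'a \<Rightarrow> bool" where
  "fresh n \<omega> \<longleftrightarrow> U (Suc n) \<omega> \<in> Some ` ({1..m} - bins n \<omega>)"

lemma occupied_subset: "occupied n u \<subseteq> {1..m}"
  by (auto simp: occupied_def)

lemma finite_occupied [simp]: "finite (occupied n u)"
  using finite_subset[OF occupied_subset] by auto

lemma occupied_mono: "n \<le> n' \<Longrightarrow> occupied n u \<subseteq> occupied n' u"
  by (fastforce simp: occupied_def)

lemma K_eq_card: "K n \<omega> = card (bins n \<omega>)"
proof -
  have "K n \<omega> = (\<Sum>l=1..m. of_bool (l \<in> bins n \<omega>))"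
    unfolding occupancy_number_def
    by (intro sum.cong arg_cong[where f=of_bool]) (auto simp: occupied_def sum_eq_0_iff simp flip: neq0_conv)
  also have "\<dots> = card ({1..m} \<inter> bins n \<omega>)"
    by (simp add: sum_of_bool_eq)
  finally show ?thesis
    using occupied_subset by (simp add: Int_absorb1)
qed

lemma K_Suc: "K (Suc n) \<omega> = K n \<omega> + of_bool (fresh n \<omega>)"
proof -
  have "bins (Suc n) \<omega> = (if fresh n \<omega> then insert (the (U (Suc n) \<omega>)) (bins n \<omega>) else bins n \<omega>)"
    by (auto simp: fresh_def occupied_def atLeastAtMostSuc_conv)
  moreover have "the (U (Suc n) \<omega>) \<notin> bins n \<omega>" if "fresh n \<omega>"
    using that by (auto simp: fresh_def)
  ultimately show ?thesis by (simp add: K_eq_card)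
qed

lemma K_mono: "n \<le> n' \<Longrightarrow> K n \<omega> \<le> K n' \<omega>"
  by (simp add: K_eq_card card_mono occupied_mono)

lemma occupied_restrict: "n' \<le> n \<Longrightarrow> occupied n' (restrict u {1..n}) = occupied n' u"
  by (fastforce simp: occupied_def)

lemma measurable_bins [measurable]: "bins n \<in> measurable M (count_space UNIV)"
proof -
  have "(\<lambda>\<omega>. \<lambda>i\<in>{1..n}. U i \<omega>) \<in> measurable M (\<Pi>\<^sub>M i\<in>{1..n}. count_space UNIV)"
    by (intro measurable_restrict measurable_U) auto
  from measurable_compose[OF this measurable_PiM_count_space_finite[of _ "occupied n"]] show ?thesis
    by (simp add: occupied_restrict del: One_nat_def)
qed

lemma measurable_K [measurable]: "K n \<in> measurable M (count_space UNIV)"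
  unfolding K_eq_card[abs_def] by measurable

section \<open>One-step transition probabilities\<close>

text \<open>The index blocks \<open>{1..n}\<close> and \<open>{Suc n}\<close> are disjoint, so the
  two restricted families are independent; \<open>P\<close> may be arbitrary because the history
  space is discrete.\<close>

lemma prob_history_U_Suc:
  "\<P>(\<omega> in M. P (\<lambda>i\<in>{1..n}. U i \<omega>) \<and> U (Suc n) \<omega> \<in> B) =
    \<P>(\<omega> in M. P (\<lambda>i\<in>{1..n}. U i \<omega>)) * \<P>(\<omega> in M. U (Suc n) \<omega> \<in> B)"
proof -
  let ?H = "\<lambda>I \<omega>. \<lambda>i\<in>I. U i \<omega>" and ?N = "\<lambda>I. \<Pi>\<^sub>M i\<in>I. count_space (UNIV :: nat option set)"
  let ?A = "{u \<in> space (?N {1..n}). P u}" and ?B = "{u \<in> space (?N {Suc n}). u (Suc n) \<in> B}"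
  have "?A \<in> sets (?N {1..n})"
    using measurable_PiM_count_space_finite[of _ P] by (simp add: pred_def)
  moreover have "?B \<in> sets (?N {Suc n})"
    by measurable
  ultimately have "prob ((\<lambda>\<omega>. (?H {1..n} \<omega>, ?H {Suc n} \<omega>)) -` (?A \<times> ?B) \<inter> space M) =
      prob (?H {1..n} -` ?A \<inter> space M) * prob (?H {Suc n} -` ?B \<inter> space M)"
    by (intro indep_varD[OF indep_var_restrict[OF indep_vars_U]]) auto
  moreover have "(\<lambda>\<omega>. (?H {1..n} \<omega>, ?H {Suc n} \<omega>)) -` (?A \<times> ?B) \<inter> space M =
      {\<omega> \<in> space M. P (?H {1..n} \<omega>) \<and> U (Suc n) \<omega> \<in> B}"
    by (auto simp: space_PiM)
  moreover have "?H {1..n} -` ?A \<inter> space M = {\<omega> \<in> space M. P (?H {1..n} \<omega>)}"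
    by (auto simp: space_PiM)
  moreover have "?H {Suc n} -` ?B \<inter> space M = {\<omega> \<in> space M. U (Suc n) \<omega> \<in> B}"
    by (auto simp: space_PiM)
  ultimately show ?thesis by simp
qed

text \<open>The event \<open>fresh n\<close> depends on the past through the set of occupied bins.
  Splitting by the value \<open>S\<close> of this set leaves a condition on draw
  \<open>Suc n\<close> alone, whose probability depends only on \<open>card S = a\<close>, so it
  factors out of the sum.\<close>

lemma prob_fresh:
  assumes "n' \<le> n"
  shows "\<P>(\<omega> in M. K n' \<omega> = t \<and> K n \<omega> = a \<and> fresh n \<omega>) =
    \<P>(\<omega> in M. K n' \<omega> = t \<and> K n \<omega> = a) * (\<theta> * (real m - real a) / real m)"
proof -
  let ?S = "{S. S \<subseteq> {1..m} \<and> card S = a}"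
  let ?E = "\<lambda>S. {\<omega> \<in> space M. K n' \<omega> = t \<and> bins n \<omega> = S}"
  let ?F = "\<lambda>S. {\<omega> \<in> space M. U (Suc n) \<omega> \<in> Some ` ({1..m} - S)}"
  have fin: "finite ?S" by simp
  have [measurable]: "U (Suc n) \<in> measurable M (count_space UNIV)"
    by (rule measurable_U) simp
  have E: "?E S \<in> events" and F: "?F S \<in> events" for S
    by measurable
  have prod: "prob (?E S \<inter> ?F S) = prob (?E S) * (\<theta> * (real m - real a) / real m)" if "S \<in> ?S" for S
  proof -
    have "prob (?E S \<inter> ?F S) = prob (?E S) * prob (?F S)"
      \<comment> \<open>As \<open>n' \<le> n\<close>, both conditions on the past are determined by
        the first \<open>n\<close> draws.\<close>
      using prob_history_U_Suc[of "\<lambda>u. card (occupied n' u) = t \<and> occupied n u = S" n "Some ` ({1..m} - S)"] assms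
      by (simp add: K_eq_card occupied_restrict Int_def conj_ac del: One_nat_def cong: conj_cong)
    moreover have "prob (?F S) = \<theta> * card ({1..m} - S) / m"
      by (rule prob_U_Some) auto
    moreover have "real (card ({1..m} - S)) = real m - real a"
      using that card_mono[of "{1..m}" S] by (auto simp: card_Diff_subset finite_subset of_nat_diff)
    ultimately show ?thesis by simp
  qed
  have "{\<omega> \<in> space M. K n' \<omega> = t \<and> K n \<omega> = a \<and> fresh n \<omega>} = (\<Union>S\<in>?S. ?E S \<inter> ?F S)"
    using occupied_subset by (auto simp: K_eq_card fresh_def)
  then have "\<P>(\<omega> in M. K n' \<omega> = t \<and> K n \<omega> = a \<and> fresh n \<omega>) = (\<Sum>S\<in>?S. prob (?E S \<inter> ?F S))"
    using fin E F by (simp only:) (intro finite_measure_finite_Union, auto simp: disjoint_family_on_def)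
  also have "\<dots> = (\<Sum>S\<in>?S. prob (?E S)) * (\<theta> * (real m - real a) / real m)"
    by (simp only: prod sum_distrib_right cong: sum.cong)
  also have "(\<Sum>S\<in>?S. prob (?E S)) = prob (\<Union>S\<in>?S. ?E S)"
    using fin E by (intro finite_measure_finite_Union[symmetric]) (auto simp: disjoint_family_on_def)
  also have "(\<Union>S\<in>?S. ?E S) = {\<omega> \<in> space M. K n' \<omega> = t \<and> K n \<omega> = a}"
    using occupied_subset by (auto simp: K_eq_card)
  finally show ?thesis .
qed

lemma pred_fresh [measurable]: "Measurable.pred M (fresh n)"
proof -
  have [measurable]: "U (Suc n) \<in> measurable M (count_space UNIV)"
    by (rule measurable_U) simp
  have [measurable]: "Measurable.pred M (\<lambda>\<omega>. l \<in> bins n \<omega>)" for l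
    by (rule measurable_compose[OF measurable_bins]) simp
  \<comment> \<open>A finite disjunction over bins replaces membership in a random set, which makes
    measurability evident.\<close>
  have "fresh n = (\<lambda>\<omega>. \<exists>l\<in>{1..m}. U (Suc n) \<omega> = Some l \<and> l \<notin> bins n \<omega>)"
    by (auto simp: fresh_def fun_eq_iff)
  also have "Measurable.pred M \<dots>"
    by measurable
  finally show ?thesis .
qed

lemma prob_not_fresh:
  assumes "n' \<le> n"
  shows "\<P>(\<omega> in M. K n' \<omega> = t \<and> K n \<omega> = a \<and> \<not> fresh n \<omega>) =
    \<P>(\<omega> in M. K n' \<omega> = t \<and> K n \<omega> = a) * (1 - \<theta> * (real m - real a) / real m)"
proof -
  let ?E = "{\<omega> \<in> space M. K n' \<omega> = t \<and> K n \<omega> = a}"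
  let ?F = "{\<omega> \<in> space M. K n' \<omega> = t \<and> K n \<omega> = a \<and> fresh n \<omega>}"
  have "{\<omega> \<in> space M. K n' \<omega> = t \<and> K n \<omega> = a \<and> \<not> fresh n \<omega>} = ?E - ?F"
    by blast
  moreover have "prob (?E - ?F) = prob ?E - prob ?F"
    by (rule finite_measure_Diff) auto
  ultimately show ?thesis
    using prob_fresh[OF assms] by (simp add: right_diff_distrib)
qed

text \<open>The value \<open>k\<close> is reached either from \<open>k\<close> without a fresh bin
  or from \<open>k - 1\<close> with one. The case \<open>k = 0\<close> is separated because
  \<open>k - 1\<close> would then be \<open>0\<close> again.\<close>

lemma prob_K_Suc:
  assumes "n' \<le> n"
  shows "\<P>(\<omega> in M. K n' \<omega> = t \<and> K (Suc n) \<omega> = k) =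
    \<P>(\<omega> in M. K n' \<omega> = t \<and> K n \<omega> = k) * (1 - \<theta> * (real m - real k) / real m) +
    (if k = 0 then 0 else
      \<P>(\<omega> in M. K n' \<omega> = t \<and> K n \<omega> = k - 1) * (\<theta> * (real m - real (k - 1)) / real m))"
proof -
  let ?F = "{\<omega> \<in> space M. K n' \<omega> = t \<and> K n \<omega> = k - 1 \<and> fresh n \<omega>}"
  let ?G = "{\<omega> \<in> space M. K n' \<omega> = t \<and> K n \<omega> = k \<and> \<not> fresh n \<omega>}"
  have "{\<omega> \<in> space M. K n' \<omega> = t \<and> K (Suc n) \<omega> = k} = ?G \<union> (if k = 0 then {} else ?F)"
    by (auto simp: K_Suc)
  moreover have "prob (?G \<union> (if k = 0 then {} else ?F)) = prob ?G + prob (if k = 0 then {} else ?F)"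
    by (rule finite_measure_Union) auto
  ultimately show ?thesis
    using prob_not_fresh[OF assms, of t k] prob_fresh[OF assms, of t "k - 1"] by simp
qed

section \<open>Joint law of two occupancy numbers\<close>

text \<open>Induction on \<open>n\<close>: since
  \<open>\<theta> (1 - t/m) / (m - t) = \<theta> / m\<close> and
  \<open>(m - t) - j = m - (t + j)\<close>, the transition weights at \<open>t + j\<close> are those
  of the recurrence for \<open>Occ\<close> at \<open>j\<close>. The joint form avoids dividing by
  the probability of \<open>K n' = t\<close>.\<close>

lemma prob_K_joint:
  assumes "t < m" "t + j \<le> m"
  shows "\<P>(\<omega> in M. K n' \<omega> = t \<and> K (n' + n) \<omega> = t + j) =
    \<P>(\<omega> in M. K n' \<omega> = t) * Occ j n (m - t) (\<theta> * (1 - real t / real m))"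
  using assms(2)
proof (induction n arbitrary: j)
  case 0
  have "{\<omega> \<in> space M. K n' \<omega> = t \<and> K n' \<omega> = t + j} =
      (if j = 0 then {\<omega> \<in> space M. K n' \<omega> = t} else {})"
    by auto
  then show ?case by (simp add: Occ_0)
next
  case (Suc n)
  let ?m = "m - t" and ?\<theta> = "\<theta> * (1 - real t / real m)"
  have m': "?m > 0" "?\<theta> \<noteq> 0" "real ?m = real m - real t"
    using assms \<theta> by (auto simp: field_simps of_nat_diff)
  have ratio: "?\<theta> * x / real ?m = \<theta> * x / real m" for x
    using assms unfolding m'(3) by (simp add: field_simps)
  note step = prob_K_Suc[of n' "n' + n" t "t + j"]
  show ?case
  proof (cases j)
    case 0
    \<comment> \<open>For \<open>j = 0\<close> the step from below drops out, because the occupancy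
      number never decreases.\<close>
    have "prob {\<omega> \<in> space M. K n' \<omega> = t \<and> K (n' + n) \<omega> = t - 1} = 0" if "t \<noteq> 0"
    proof -
      have "\<not> (K n' \<omega> = t \<and> K (n' + n) \<omega> = t - 1)" for \<omega>
        using that K_mono[of n' "n' + n" \<omega>] by auto
      then have "{\<omega> \<in> space M. K n' \<omega> = t \<and> K (n' + n) \<omega> = t - 1} = {}"
        by blast
      then show ?thesis
        by (simp only: measure_empty)
    qed
    moreover have "1 - \<theta> * (real m - real t) / real m = 1 - ?\<theta>"
      using m by (simp add: field_simps)
    ultimately show ?thesis
      using step Suc.IH[of 0] Suc.prems 0 by (simp add: Occ_0_Suc[OF m'(1,2)])
  next
    case j: (Suc i)
    have "?\<theta> * (real ?m - real (Suc i)) / real ?m = \<theta> * (real m - real (t + j)) / real m"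
      "?\<theta> * (real ?m - real i) / real ?m = \<theta> * (real m - real (t + i)) / real m"
      unfolding ratio unfolding m'(3) j by (simp_all add: algebra_simps)
    then show ?thesis
      using step Suc.IH[of i] Suc.IH[of j] Suc.prems j
      by (simp add: Occ_Suc_Suc[OF m'(1,2)] distrib_left mult_ac)
  qed
qed

end

theorem mainTheorem3:
  fixes M :: "'a measure" and U' Q :: "nat \<Rightarrow> 'a \<Rightarrow> nat"
    and m n n' t k :: nat and \<theta> :: real
  assumes "m \<ge> 1" and "0 < \<theta>" and "\<theta> \<le> 1"
    and "extended_occupancy_process M m \<theta> U' Q"
    and "n \<ge> 1" and "t \<le> k" and "k \<le> min n m"
  shows "\<P>(\<omega> in M. occupancy_number m U' Q n \<omega> = k) = Occ k n m \<theta> \<and>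
    (t < m \<longrightarrow> \<P>(\<omega> in M. occupancy_number m U' Q n' \<omega> = t) > 0 \<longrightarrow>
      \<P>(\<omega> in M. occupancy_number m U' Q (n' + n) \<omega> = k
          \<bar> occupancy_number m U' Q n' \<omega> = t)
        = Occ (k - t) n (m - t) (\<theta> * (1 - real t / real m)))"
proof -
  interpret extended_occupancy M m \<theta> U' Q
    using assms by unfold_locales
  have K0: "K 0 \<omega> = 0" for \<omega>
    by (simp add: occupancy_number_def)
  have "\<P>(\<omega> in M. K n \<omega> = k) = Occ k n m \<theta>"
    \<comment> \<open>With \<open>n' = t = 0\<close> the condition \<open>K 0 = 0\<close> always
      holds, and the modified parameter reduces to \<open>\<theta>\<close>.\<close>
    using prob_K_joint[of 0 k 0 n] assms by (simp add: K0 prob_space)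
  moreover have "\<P>(\<omega> in M. K (n' + n) \<omega> = k \<bar> K n' \<omega> = t) =
      Occ (k - t) n (m - t) (\<theta> * (1 - real t / real m))"
    if "t < m" "\<P>(\<omega> in M. K n' \<omega> = t) > 0"
    using prob_K_joint[of t "k - t" n' n] that assms by (simp add: cond_prob_def conj_commute)
  ultimately show ?thesis by blast
qed

end
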